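(* Let $X$ be the metric hedgehog formed by countably infinitely many copies of $[0,1]$ whose origins are identified, equipped with its metric topology $\tau_d$ and its natural median $m$. Then $(X,m,\tau_d)$ admits no proper median compactification.
   Context: The hedgehog metric $d$ is $d(x,y)=|x-y|$ if $x,y$ lie on the same arm $[0,1]_n$, and $d(x,y)=x+y$ if they lie on different arms. For all $x,y,z$ there is a unique point $m(x,y,z)$ lying metrically between each two of them (i.e. $d(x,m)+d(m,y)=d(x,y)$ and similarly for the other pairs); this defines the median $m$, making $X$ a median algebra, and $m$ is $\tau_d$-continuous. A topological median algebra is a Hausdorff topological space with a continuous median operation (a ternary operation symmetric in all variables with $m(a,b,b)=b$ and $m(m(a,x,b),x,c)=m(a,x,m(b,x,c))$). A median compactification of a topological median algebra $X$ is a pair $(K,\eta)$ where $K$ is a compact Hausdorff topological median algebra and $\eta\colon X\to K$ is a continuous median-preserving map with dense image; it is proper if $\eta$ is a topological embedding. *)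

theory Defs
  imports "HOL-Analysis.Analysis"
begin

section \<open>Median compactifications\<close>

locale median_algebra =
  fixes M :: "'a set" and m :: "'a \<Rightarrow> 'a \<Rightarrow> 'a \<Rightarrow> 'a"
  assumes median_closed: "\<lbrakk>a \<in> M; b \<in> M; c \<in> M\<rbrakk> \<Longrightarrow> m a b c \<in> M"
    and median_sym12: "\<lbrakk>a \<in> M; b \<in> M; c \<in> M\<rbrakk> \<Longrightarrow> m a b c = m b a c"
    and median_sym23: "\<lbrakk>a \<in> M; b \<in> M; c \<in> M\<rbrakk> \<Longrightarrow> m a b c = m a c b"
    and median_absorb: "\<lbrakk>a \<in> M; b \<in> M\<rbrakk> \<Longrightarrow> m a b b = b"
    and median_assoc: "\<lbrakk>a \<in> M; b \<in> M; c \<in> M; x \<in> M\<rbrakk>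
                        \<Longrightarrow> m (m a x b) x c = m a x (m b x c)"

locale topological_median_algebra = median_algebra "topspace T" m
  for T :: "'a topology" and m :: "'a \<Rightarrow> 'a \<Rightarrow> 'a \<Rightarrow> 'a" +
  assumes Hausdorff: "Hausdorff_space T"
    and continuous_median:
      "continuous_map (prod_topology T (prod_topology T T)) T (\<lambda>(a, b, c). m a b c)"

text \<open>The source \<open>(X, mX)\<close> is meant to be a topological median algebra, but this is not
  made part of the predicate, so that a nonexistence statement cannot hold merely because the
  source fails to be one.\<close>

definition median_compactification ::
  "'a topology \<Rightarrow> ('a \<Rightarrow> 'a \<Rightarrow> 'a \<Rightarrow> 'a) \<Rightarrow> 'k topology \<Rightarrow> ('k \<Rightarrow> 'k \<Rightarrow> 'k \<Rightarrow> 'k) \<Rightarrow> ('a \<Rightarrow> 'k) \<Rightarrow> bool"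
  where
  "median_compactification X mX K mK \<eta> \<longleftrightarrow>
     topological_median_algebra K mK \<and>
     compact_space K \<and>
     continuous_map X K \<eta> \<and>
     (\<forall>a\<in>topspace X. \<forall>b\<in>topspace X. \<forall>c\<in>topspace X. \<eta> (mX a b c) = mK (\<eta> a) (\<eta> b) (\<eta> c)) \<and>
     K closure_of (\<eta> ` topspace X) = topspace K"

definition proper_median_compactification ::
  "'a topology \<Rightarrow> ('a \<Rightarrow> 'a \<Rightarrow> 'a \<Rightarrow> 'a) \<Rightarrow> 'k topology \<Rightarrow> ('k \<Rightarrow> 'k \<Rightarrow> 'k \<Rightarrow> 'k) \<Rightarrow> ('a \<Rightarrow> 'k) \<Rightarrow> bool"
  where
  "proper_median_compactification X mX K mK \<eta> \<longleftrightarrow>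
     median_compactification X mX K mK \<eta> \<and> embedding_map X K \<eta>"


section \<open>The metric hedgehog with countably many arms\<close>

text \<open>A pair \<open>(n, t)\<close> with \<open>0 \<le> t \<le> 1\<close> represents the point \<open>t\<close> of the \<open>n\<close>-th copy of the
  unit interval; all pairs \<open>(n, 0)\<close> represent the common origin.\<close>

definition hedgehog_rel :: "nat \<times> real \<Rightarrow> nat \<times> real \<Rightarrow> bool" where
  "hedgehog_rel p q \<longleftrightarrow>
     snd p \<in> {0..1} \<and> snd q \<in> {0..1} \<and> (p = q \<or> snd p = 0 \<and> snd q = 0)"

quotient_type hedgehog = "nat \<times> real" / partial: hedgehog_rel
proof (rule part_equivpI)
  show "\<exists>p. hedgehog_rel p p"
    by (rule exI[of _ "(0, 0)"]) (simp add: hedgehog_rel_def)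
  show "symp hedgehog_rel"
    by (auto simp: symp_def hedgehog_rel_def)
  show "transp hedgehog_rel"
    by (auto simp: transp_def hedgehog_rel_def)
qed

lift_definition hedgehog_dist :: "hedgehog \<Rightarrow> hedgehog \<Rightarrow> real" is
  "\<lambda>p q. if fst p = fst q then \<bar>snd p - snd q\<bar> else snd p + snd q"
  by (auto simp: hedgehog_rel_def)

lemma Metric_space_hedgehog: "Metric_space UNIV hedgehog_dist"
proof
  fix x y z :: hedgehog
  show "0 \<le> hedgehog_dist x y"
    by transfer (auto simp: hedgehog_rel_def)
  show "hedgehog_dist x y = hedgehog_dist y x"
    by transfer (auto simp: hedgehog_rel_def)
  show "hedgehog_dist x y = 0 \<longleftrightarrow> x = y"
    by transfer (auto simp: hedgehog_rel_def prod_eq_iff split: if_splits)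
  show "hedgehog_dist x z \<le> hedgehog_dist x y + hedgehog_dist y z"
    by transfer (auto simp: hedgehog_rel_def)
qed

definition hedgehog_topology :: "hedgehog topology" where
  "hedgehog_topology = Metric_space.mtopology UNIV hedgehog_dist"

definition hedgehog_median :: "hedgehog \<Rightarrow> hedgehog \<Rightarrow> hedgehog \<Rightarrow> hedgehog" where
  "hedgehog_median x y z =
     (THE m. hedgehog_dist x m + hedgehog_dist m y = hedgehog_dist x y \<and>
             hedgehog_dist y m + hedgehog_dist m z = hedgehog_dist y z \<and>
             hedgehog_dist x m + hedgehog_dist m z = hedgehog_dist x z)"

text \<open>The definite description in the median always denotes.\<close>

lemma hedgehog_median_ex1:
  "\<exists>!m. hedgehog_dist x m + hedgehog_dist m y = hedgehog_dist x y \<and>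
        hedgehog_dist y m + hedgehog_dist m z = hedgehog_dist y z \<and>
        hedgehog_dist x m + hedgehog_dist m z = hedgehog_dist x z"
proof (rule ex_ex1I)
  show "\<exists>m. hedgehog_dist x m + hedgehog_dist m y = hedgehog_dist x y \<and>
        hedgehog_dist y m + hedgehog_dist m z = hedgehog_dist y z \<and>
        hedgehog_dist x m + hedgehog_dist m z = hedgehog_dist x z"
  proof (transfer, clarsimp simp only: split_paired_all fst_conv snd_conv)
    fix i j k :: nat and r s t :: real
    assume "hedgehog_rel (i, r) (i, r)" "hedgehog_rel (j, s) (j, s)" "hedgehog_rel (k, t) (k, t)"
    then have b: "r \<in> {0..1}" "s \<in> {0..1}" "t \<in> {0..1}"
      by (auto simp: hedgehog_rel_def)
    define p where "p =
      (if i = j \<and> j = k then (i, max (min r s) (min (max r s) t))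
       else if i = j then (i, min r s) else if j = k then (j, min s t)
       else if i = k then (i, min r t) else (0, 0))"
    show "\<exists>m\<in>{p. hedgehog_rel p p}.
      (if i = fst m then \<bar>r - snd m\<bar> else r + snd m) +
      (if fst m = j then \<bar>snd m - s\<bar> else snd m + s) = (if i = j then \<bar>r - s\<bar> else r + s) \<and>
      (if j = fst m then \<bar>s - snd m\<bar> else s + snd m) +
      (if fst m = k then \<bar>snd m - t\<bar> else snd m + t) = (if j = k then \<bar>s - t\<bar> else s + t) \<and>
      (if i = fst m then \<bar>r - snd m\<bar> else r + snd m) +
      (if fst m = k then \<bar>snd m - t\<bar> else snd m + t) = (if i = k then \<bar>r - t\<bar> else r + t)"
      using b by (intro bexI[of _ p]) (auto simp: p_def hedgehog_rel_def min_def max_def)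
  qed
next
  fix m m' :: hedgehog
  assume "hedgehog_dist x m + hedgehog_dist m y = hedgehog_dist x y \<and>
      hedgehog_dist y m + hedgehog_dist m z = hedgehog_dist y z \<and>
      hedgehog_dist x m + hedgehog_dist m z = hedgehog_dist x z"
    and "hedgehog_dist x m' + hedgehog_dist m' y = hedgehog_dist x y \<and>
      hedgehog_dist y m' + hedgehog_dist m' z = hedgehog_dist y z \<and>
      hedgehog_dist x m' + hedgehog_dist m' z = hedgehog_dist x z"
  then have "hedgehog_dist m m' = 0"
  proof (transfer, simp only: split_paired_all fst_conv snd_conv)
    fix i j k p q :: nat and r s t u v :: real
    assume b: "hedgehog_rel (i, r) (i, r)" "hedgehog_rel (j, s) (j, s)" "hedgehog_rel (k, t) (k, t)"
      "hedgehog_rel (p, u) (p, u)" "hedgehog_rel (q, v) (q, v)"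
    assume 1: "(if i = p then \<bar>r - u\<bar> else r + u) + (if p = j then \<bar>u - s\<bar> else u + s)
        = (if i = j then \<bar>r - s\<bar> else r + s) \<and>
      (if j = p then \<bar>s - u\<bar> else s + u) + (if p = k then \<bar>u - t\<bar> else u + t)
        = (if j = k then \<bar>s - t\<bar> else s + t) \<and>
      (if i = p then \<bar>r - u\<bar> else r + u) + (if p = k then \<bar>u - t\<bar> else u + t)
        = (if i = k then \<bar>r - t\<bar> else r + t)"
    assume 2: "(if i = q then \<bar>r - v\<bar> else r + v) + (if q = j then \<bar>v - s\<bar> else v + s)
        = (if i = j then \<bar>r - s\<bar> else r + s) \<and>
      (if j = q then \<bar>s - v\<bar> else s + v) + (if q = k then \<bar>v - t\<bar> else v + t)
        = (if j = k then \<bar>s - t\<bar> else s + t) \<and>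
      (if i = q then \<bar>r - v\<bar> else r + v) + (if q = k then \<bar>v - t\<bar> else v + t)
        = (if i = k then \<bar>r - t\<bar> else r + t)"
    have "r \<ge> 0" "s \<ge> 0" "t \<ge> 0" "u \<ge> 0" "v \<ge> 0"
      using b by (auto simp: hedgehog_rel_def)
    then show "(if p = q then \<bar>u - v\<bar> else u + v) = 0"
      using 1 2 by (smt (verit))
  qed
  then show "m = m'"
    using Metric_space.zero[OF Metric_space_hedgehog] by simp
qed

end

theory Submission imports Defs begin

text \<open>
  Call two points of a median algebra orthogonal at \<open>p\<close> if their median with \<open>p\<close> is \<open>p\<close>. In a
  topological median algebra, a set \<open>S\<close> of points that are pairwise orthogonal at \<open>p\<close> can accumulate
  only at \<open>p\<close>: orthogonality is a closed condition, so it passes from pairs of points of \<open>S\<close> first to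
  pairs consisting of an accumulation point \<open>a\<close> and a point of \<open>S\<close>, and then to the pair \<open>(a, a)\<close>,
  whose median with \<open>p\<close> is \<open>a\<close> (lemma \<open>derived_set_of_orthogonal\<close>).

  If \<open>S\<close> is infinite, its image in a compact median algebra must accumulate somewhere, hence at the
  image of \<open>p\<close>, and if the map is an embedding this forces \<open>S\<close> to accumulate at \<open>p\<close> already in the
  source (lemma \<open>infinite_orthogonal_accumulates\<close>). The end points of the arms of the hedgehog are
  infinitely many and pairwise orthogonal at the origin, but all have distance 1 from it.
\<close>

context topological_median_algebra
begin

lemma median_sym13:
  assumes "a \<in> topspace T" "b \<in> topspace T" "c \<in> topspace T"
  shows "m a b c = m c b a"
  using assms by (metis median_sym12 median_sym23)

lemma closedin_orthogonal:
  assumes y: "y \<in> topspace T" and p: "p \<in> topspace T"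
  shows "closedin T {x \<in> topspace T. m x y p = p}"
proof -
  have "continuous_map T (prod_topology T (prod_topology T T)) (\<lambda>x. (x, y, p))"
    using y p by (intro continuous_map_pairedI) auto
  from continuous_map_compose[OF this continuous_median]
  have "continuous_map T T (\<lambda>x. m x y p)"
    by (simp add: o_def)
  moreover have "closedin T {p}"
    using Hausdorff p by (simp add: closedin_Hausdorff_singleton)
  ultimately have "closedin T {x \<in> topspace T. m x y p \<in> {p}}"
    by (rule closedin_continuous_map_preimage)
  then show ?thesis
    by simp
qed

text \<open>Orthogonality to a fixed point is a closed condition, so it holds at every accumulation point
  of a set on which it holds up to finitely many exceptions. This is used twice, once in each
  argument of the median.\<close>

lemma derived_set_of_orthogonal:
  assumes S: "S \<subseteq> topspace T" and p: "p \<in> topspace T"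
    and orth: "\<And>x y. x \<in> S \<Longrightarrow> y \<in> S \<Longrightarrow> x \<noteq> y \<Longrightarrow> m x y p = p"
  shows "T derived_set_of S \<subseteq> {p}"
proof
  fix a
  assume a: "a \<in> T derived_set_of S"
  then have aT: "a \<in> topspace T"
    using derived_set_of_subset_topspace[of T S] by blast
  have orth_a: "m a y p = p" if y: "y \<in> S" for y
  proof -
    let ?C = "{x \<in> topspace T. m x y p = p}"
    \<comment> \<open>Since \<open>m y y p = y\<close>, the point \<open>y\<close> is orthogonal to itself only if \<open>y = p\<close>.\<close>
    have "S \<subseteq> ?C \<union> {y}"
      using S y orth by blast
    then have "T derived_set_of S \<subseteq> T derived_set_of (?C \<union> {y})"
      by (rule derived_set_of_mono)
    then have "a \<in> T derived_set_of ?C \<union> T derived_set_of {y}"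
      unfolding derived_set_of_Un using a by (rule subsetD)
    moreover have "T derived_set_of {y} = {}"
      using Hausdorff_imp_t1_space[OF Hausdorff] by (simp add: t1_space_derived_set_of_finite)
    moreover have "T derived_set_of ?C \<subseteq> ?C"
      using closedin_orthogonal[of y p] S y p by (auto simp: closedin_contains_derived_set)
    ultimately show ?thesis
      by blast
  qed
  let ?D = "{x \<in> topspace T. m x a p = p}"
  have "S \<subseteq> ?D"
  proof
    fix x
    assume x: "x \<in> S"
    then have "x \<in> topspace T"
      using S by blast
    then show "x \<in> ?D"
      using median_sym12[OF _ aT p, of x] orth_a[OF x] by simp
  qed
  moreover have "T derived_set_of ?D \<subseteq> ?D"
    using closedin_orthogonal[OF aT p] by (auto simp: closedin_contains_derived_set)
  ultimately have "m a a p = p"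
    using a derived_set_of_mono[of S ?D T] by blast
  moreover have "m a a p = a"
    using median_sym13[OF aT aT p] median_absorb[OF p aT] by simp
  ultimately show "a \<in> {p}"
    by simp
qed

end

text \<open>Hence an infinite set of points that are pairwise orthogonal at \<open>p\<close> and bounded away from \<open>p\<close>
  obstructs proper median compactifications.\<close>

lemma infinite_orthogonal_accumulates:
  assumes cpt: "proper_median_compactification X mX K mK \<eta>"
    and inf: "infinite S" and S: "S \<subseteq> topspace X" and p: "p \<in> topspace X"
    and orth: "\<And>x y. x \<in> S \<Longrightarrow> y \<in> S \<Longrightarrow> x \<noteq> y \<Longrightarrow> mX x y p = p"
  shows "p \<in> X derived_set_of S"
proof -
  let ?V = "\<eta> ` topspace X"
  have tma: "topological_median_algebra K mK" and compact: "compact_space K"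
    and cont: "continuous_map X K \<eta>"
    and hom: "\<And>a b c. a \<in> topspace X \<Longrightarrow> b \<in> topspace X \<Longrightarrow> c \<in> topspace X \<Longrightarrow>
                \<eta> (mX a b c) = mK (\<eta> a) (\<eta> b) (\<eta> c)"
    and emb: "homeomorphic_map X (subtopology K ?V) \<eta>"
    using cpt by (auto simp: proper_median_compactification_def median_compactification_def
        embedding_map_def)
  have inj: "inj_on \<eta> (topspace X)"
    using emb by (simp add: homeomorphic_eq_everything_map)
  have V: "?V \<subseteq> topspace K"
    using cont by (rule continuous_map_image_subset_topspace)
  have "K derived_set_of (\<eta> ` S) \<subseteq> {\<eta> p}"
  proof (rule topological_median_algebra.derived_set_of_orthogonal[OF tma])
    show "mK u v (\<eta> p) = \<eta> p" if uv_in: "u \<in> \<eta> ` S" "v \<in> \<eta> ` S" and "u \<noteq> v" for u v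
    proof -
      obtain x y where xy: "x \<in> S" "y \<in> S" and uv: "u = \<eta> x" "v = \<eta> y"
        using uv_in by blast
      from xy have "\<eta> (mX x y p) = mK (\<eta> x) (\<eta> y) (\<eta> p)"
        using S p by (intro hom) auto
      moreover from xy have "mX x y p = p"
        by (rule orth) (use uv \<open>u \<noteq> v\<close> in auto)
      ultimately show ?thesis
        by (simp add: uv)
    qed
  qed (use S V p in auto)
  moreover have "K derived_set_of (\<eta> ` S) \<noteq> {}"
  proof (rule compact_space_imp_Bolzano_Weierstrass[OF compact])
    show "infinite (\<eta> ` S)"
      using inf inj S by (meson finite_imageD inj_on_subset)
  qed (use S V in auto)
  ultimately have "\<eta> p \<in> K derived_set_of (\<eta> ` S)"
    by blast
  moreover have "?V \<inter> \<eta> ` S = \<eta> ` S"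
    using S by blast
  ultimately have "\<eta> p \<in> subtopology K ?V derived_set_of (\<eta> ` S)"
    using p by (simp add: derived_set_of_subtopology)
  also have "\<dots> = \<eta> ` (X derived_set_of S)"
    by (rule homeomorphic_map_derived_set_of[OF emb S])
  finally show ?thesis
    using inj_on_image_mem_iff[OF inj p derived_set_of_subset_topspace] by blast
qed

lift_definition hedgehog_origin :: hedgehog is "(0, 0)"
  by (simp add: hedgehog_rel_def)

lift_definition hedgehog_tip :: "nat \<Rightarrow> hedgehog" is "\<lambda>n. (n, 1)"
  by (simp add: hedgehog_rel_def)

lemma hedgehog_dist_tip_origin: "hedgehog_dist (hedgehog_tip n) hedgehog_origin = 1"
  by transfer simp

lemma hedgehog_dist_tips: "i \<noteq> j \<Longrightarrow> hedgehog_dist (hedgehog_tip i) (hedgehog_tip j) = 2"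
  by transfer simp

lemma inj_hedgehog_tip: "inj hedgehog_tip"
proof (rule injI)
  fix i j
  assume "hedgehog_tip i = hedgehog_tip j"
  then have "hedgehog_dist (hedgehog_tip i) (hedgehog_tip j) = 0"
    by (simp add: Metric_space.zero[OF Metric_space_hedgehog])
  then show "i = j"
    using hedgehog_dist_tips by fastforce
qed

lemma hedgehog_tips_orthogonal:
  assumes "i \<noteq> j"
  shows "hedgehog_median (hedgehog_tip i) (hedgehog_tip j) hedgehog_origin = hedgehog_origin"
  unfolding hedgehog_median_def
proof (rule the1_equality[OF hedgehog_median_ex1])
  have "hedgehog_dist hedgehog_origin (hedgehog_tip j) = 1"
    using hedgehog_dist_tip_origin Metric_space.commute[OF Metric_space_hedgehog] by metis
  then show "hedgehog_dist (hedgehog_tip i) hedgehog_origin +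
        hedgehog_dist hedgehog_origin (hedgehog_tip j) =
      hedgehog_dist (hedgehog_tip i) (hedgehog_tip j) \<and>
      hedgehog_dist (hedgehog_tip j) hedgehog_origin +
        hedgehog_dist hedgehog_origin hedgehog_origin =
      hedgehog_dist (hedgehog_tip j) hedgehog_origin \<and>
      hedgehog_dist (hedgehog_tip i) hedgehog_origin +
        hedgehog_dist hedgehog_origin hedgehog_origin =
      hedgehog_dist (hedgehog_tip i) hedgehog_origin"
    using assms by (simp add: hedgehog_dist_tip_origin hedgehog_dist_tips
        Metric_space.zero[OF Metric_space_hedgehog])
qed

lemma topspace_hedgehog [simp]: "topspace hedgehog_topology = UNIV"
  by (simp add: hedgehog_topology_def Metric_space.topspace_mtopology[OF Metric_space_hedgehog])

lemma hedgehog_origin_not_in_derived_set: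
  "hedgehog_origin \<notin> hedgehog_topology derived_set_of (range hedgehog_tip)"
proof
  interpret Metric_space UNIV hedgehog_dist
    by (rule Metric_space_hedgehog)
  assume "hedgehog_origin \<in> hedgehog_topology derived_set_of (range hedgehog_tip)"
  moreover have "openin hedgehog_topology (mball hedgehog_origin 1)"
    unfolding hedgehog_topology_def by (rule openin_mball)
  moreover have "hedgehog_origin \<in> mball hedgehog_origin 1"
    by simp
  ultimately obtain n where "hedgehog_tip n \<in> mball hedgehog_origin 1"
    unfolding in_derived_set_of by blast
  then show False
    by (simp add: commute[of hedgehog_origin] hedgehog_dist_tip_origin)
qed

theorem corollary5p14:
  "\<not> (\<exists>(K :: 'k topology) (mK :: 'k \<Rightarrow> 'k \<Rightarrow> 'k \<Rightarrow> 'k) (\<eta> :: hedgehog \<Rightarrow> 'k).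
        proper_median_compactification hedgehog_topology hedgehog_median K mK \<eta>)"
proof
  assume "\<exists>(K :: 'k topology) (mK :: 'k \<Rightarrow> 'k \<Rightarrow> 'k \<Rightarrow> 'k) (\<eta> :: hedgehog \<Rightarrow> 'k).
        proper_median_compactification hedgehog_topology hedgehog_median K mK \<eta>"
  then obtain K :: "'k topology" and mK and \<eta> :: "hedgehog \<Rightarrow> 'k"
    where cpt: "proper_median_compactification hedgehog_topology hedgehog_median K mK \<eta>"
    by blast
  have "hedgehog_origin \<in> hedgehog_topology derived_set_of (range hedgehog_tip)"
  proof (rule infinite_orthogonal_accumulates[OF cpt])
    show "infinite (range hedgehog_tip)"
      using inj_hedgehog_tip by (rule range_inj_infinite)
    show "hedgehog_median x y hedgehog_origin = hedgehog_origin"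
      if "x \<in> range hedgehog_tip" "y \<in> range hedgehog_tip" "x \<noteq> y" for x y
      using that by (auto intro: hedgehog_tips_orthogonal)
  qed auto
  with hedgehog_origin_not_in_derived_set show False
    by contradiction
qed

end
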